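(* Let $(A,\mu)$ be a Novikov algebra over $\mathbf{k}$ and let $\alpha \colon A \to A$ be an algebra morphism. Then $A_\alpha = (A,\mu_\alpha,\alpha)$, where $\mu_\alpha = \alpha \circ \mu$, is a Hom-Novikov algebra.
   Context: Throughout, $\mathbf{k}$ is a ground field of characteristic $0$; vector spaces and (bi)linear maps are over $\mathbf{k}$. Given a bilinear multiplication $\mu \colon A^{\otimes 2} \to A$, write $xy$ for $\mu(x,y)$. A Novikov algebra is a vector space $A$ with a bilinear multiplication $\mu \colon A^{\otimes 2} \to A$ such that for all $x,y,z \in A$: $(xy)z - x(yz) = (yx)z - y(xz)$ and $(xy)z = (xz)y$. (No associativity or unit is assumed.) An algebra morphism $f \colon A \to A$ on $(A,\mu)$ is a linear map with $f \circ \mu = \mu \circ f^{\otimes 2}$, i.e. $f(xy) = f(x)f(y)$ for all $x,y \in A$. A Hom-Novikov algebra is a triple $(A,\mu,\alpha)$ where $A$ is a vector space, $\mu \colon A^{\otimes 2} \to A$ is a bilinear map (written $xy=\mu(x,y)$) and $\alpha \colon A \to A$ is a linear map, such that for all $x,y,z \in A$: (i) $\alpha(xy) = \alpha(x)\alpha(y)$; (ii) $(xy)\alpha(z) - \alpha(x)(yz) = (yx)\alpha(z) - \alpha(y)(xz)$; (iii) $(xy)\alpha(z) = (xz)\alpha(y)$. *)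

theory Defs
  imports Complex_Main
begin

text \<open>
  A vector space over a field of characteristic 0 is given by a scalar multiplication
  on an abelian group: the field is the type \<open>'k\<close>, and \<open>A\<close> is the whole type \<open>'a\<close>.
  A map out of \<open>A \<otimes> A\<close> is represented by the corresponding bilinear map in curried form.
\<close>

locale bilinear_algebra = vector_space scale
  for scale :: "'k::field_char_0 \<Rightarrow> 'a::ab_group_add \<Rightarrow> 'a" +
  fixes mult :: "'a \<Rightarrow> 'a \<Rightarrow> 'a"
  assumes linear_left: "\<And>y. Vector_Spaces.linear scale scale (\<lambda>x. mult x y)"
    and linear_right: "\<And>x. Vector_Spaces.linear scale scale (\<lambda>y. mult x y)"

locale novikov_algebra = bilinear_algebra scale mult
  for scale :: "'k::field_char_0 \<Rightarrow> 'a::ab_group_add \<Rightarrow> 'a"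
    and mult :: "'a \<Rightarrow> 'a \<Rightarrow> 'a" (infixl "\<cdot>" 70) +
  assumes left_symmetric:
      "\<And>x y z. (x \<cdot> y) \<cdot> z - x \<cdot> (y \<cdot> z) = (y \<cdot> x) \<cdot> z - y \<cdot> (x \<cdot> z)"
    and right_commute: "\<And>x y z. (x \<cdot> y) \<cdot> z = (x \<cdot> z) \<cdot> y"

locale algebra_morphism = bilinear_algebra scale mult
  for scale :: "'k::field_char_0 \<Rightarrow> 'a::ab_group_add \<Rightarrow> 'a"
    and mult :: "'a \<Rightarrow> 'a \<Rightarrow> 'a" (infixl "\<cdot>" 70) +
  fixes f :: "'a \<Rightarrow> 'a"
  assumes linear_morphism: "Vector_Spaces.linear scale scale f"
    and map_mult: "\<And>x y. f (x \<cdot> y) = f x \<cdot> f y"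

locale hom_novikov_algebra = bilinear_algebra scale mult
  for scale :: "'k::field_char_0 \<Rightarrow> 'a::ab_group_add \<Rightarrow> 'a"
    and mult :: "'a \<Rightarrow> 'a \<Rightarrow> 'a" (infixl "\<cdot>" 70) +
  fixes \<alpha> :: "'a \<Rightarrow> 'a"
  assumes linear_twist: "Vector_Spaces.linear scale scale \<alpha>"
    and twist_mult: "\<And>x y. \<alpha> (x \<cdot> y) = \<alpha> x \<cdot> \<alpha> y"
    and hom_left_symmetric:
      "\<And>x y z. (x \<cdot> y) \<cdot> \<alpha> z - \<alpha> x \<cdot> (y \<cdot> z) = (y \<cdot> x) \<cdot> \<alpha> z - \<alpha> y \<cdot> (x \<cdot> z)"
    and hom_right_commute: "\<And>x y z. (x \<cdot> y) \<cdot> \<alpha> z = (x \<cdot> z) \<cdot> \<alpha> y"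

definition twisted_mult :: "('a \<Rightarrow> 'a) \<Rightarrow> ('a \<Rightarrow> 'a \<Rightarrow> 'a) \<Rightarrow> 'a \<Rightarrow> 'a \<Rightarrow> 'a" where
  "twisted_mult \<alpha> \<mu> = (\<lambda>x y. \<alpha> (\<mu> x y))"

end

theory Submission
  imports Defs
begin

text \<open>
  Since \<open>\<alpha>\<close> is multiplicative, each term in the Hom-Novikov identities of the twisted product
  is \<open>\<alpha> \<circ> \<alpha>\<close> of the corresponding term in the Novikov identities.
\<close>

theorem theorem1p1:
  fixes scale :: "'k::field_char_0 \<Rightarrow> 'a::ab_group_add \<Rightarrow> 'a"
    and \<mu> :: "'a \<Rightarrow> 'a \<Rightarrow> 'a"
    and \<alpha> :: "'a \<Rightarrow> 'a"
  assumes "novikov_algebra scale \<mu>"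
    and "algebra_morphism scale \<mu> \<alpha>"
  shows "hom_novikov_algebra scale (twisted_mult \<alpha> \<mu>) \<alpha>"
proof -
  interpret N: novikov_algebra scale \<mu> by fact
  interpret M: algebra_morphism scale \<mu> \<alpha> by fact
  \<comment> \<open>This makes \<open>L.diff\<close> available: left symmetry is an identity between
    differences, so \<alpha> has to pass through subtraction as well as through products.\<close>
  interpret L: Vector_Spaces.linear scale scale \<alpha> by (rule M.linear_morphism)
  show ?thesis
  proof (intro hom_novikov_algebra.intro hom_novikov_algebra_axioms.intro
      bilinear_algebra.intro bilinear_algebra_axioms.intro)
    show "vector_space scale" by (rule N.vector_space_axioms)
    show "Vector_Spaces.linear scale scale \<alpha>" by (rule M.linear_morphism)
    fix x y z
    show "Vector_Spaces.linear scale scale (\<lambda>x. twisted_mult \<alpha> \<mu> x y)"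
      using Vector_Spaces.linear_compose[OF N.linear_left M.linear_morphism]
      by (simp add: twisted_mult_def comp_def)
    show "Vector_Spaces.linear scale scale (\<lambda>y. twisted_mult \<alpha> \<mu> x y)"
      using Vector_Spaces.linear_compose[OF N.linear_right M.linear_morphism]
      by (simp add: twisted_mult_def comp_def)
    show "\<alpha> (twisted_mult \<alpha> \<mu> x y) = twisted_mult \<alpha> \<mu> (\<alpha> x) (\<alpha> y)"
      by (simp add: twisted_mult_def M.map_mult)
    \<comment> \<open>Applying \<alpha> twice matches the twisted identity: one \<alpha> comes from
      the outer twisted product, the other from the inner product or from the twisted
      argument.\<close>
    have "\<alpha> (\<alpha> (\<mu> (\<mu> x y) z - \<mu> x (\<mu> y z))) = \<alpha> (\<alpha> (\<mu> (\<mu> y x) z - \<mu> y (\<mu> x z)))"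
      by (simp only: N.left_symmetric)
    then show "twisted_mult \<alpha> \<mu> (twisted_mult \<alpha> \<mu> x y) (\<alpha> z)
        - twisted_mult \<alpha> \<mu> (\<alpha> x) (twisted_mult \<alpha> \<mu> y z)
      = twisted_mult \<alpha> \<mu> (twisted_mult \<alpha> \<mu> y x) (\<alpha> z)
        - twisted_mult \<alpha> \<mu> (\<alpha> y) (twisted_mult \<alpha> \<mu> x z)"
      by (simp add: twisted_mult_def M.map_mult L.diff)
    show "twisted_mult \<alpha> \<mu> (twisted_mult \<alpha> \<mu> x y) (\<alpha> z)
      = twisted_mult \<alpha> \<mu> (twisted_mult \<alpha> \<mu> x z) (\<alpha> y)"
      \<comment> \<open>Unfolding pushes every \<alpha> down to the variables, leaving right
        commutativity of \<mu> at \<open>\<alpha> (\<alpha> x)\<close>,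
        \<open>\<alpha> (\<alpha> y)\<close>, \<open>\<alpha> (\<alpha> z)\<close>.\<close>
      unfolding twisted_mult_def M.map_mult by (rule N.right_commute)
  qed
qed

end
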